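(* Every zerosumfree semiring is Armendariz.
   Context: A semiring is an algebraic structure $(S,+,\cdot,0,1)$ such that $(S,+,0)$ is a commutative monoid, $(S,\cdot,1)$ is a (not necessarily commutative) monoid with $1\neq 0$, $a(b+c)=ab+ac$ and $(b+c)a=ba+ca$ for all $a,b,c\in S$, and $a\cdot 0=0\cdot a=0$ for all $a\in S$. $S$ is zerosumfree if $s+t=0$ implies $s=t=0$ for all $s,t\in S$. $S[X]$ is the polynomial semiring in an indeterminate $X$ commuting with the coefficients. $S$ is Armendariz if whenever $f=\sum_{i=0}^m a_iX^i$ and $g=\sum_{j=0}^n b_jX^j$ in $S[X]$ satisfy $fg=0$, then $a_ib_j=0$ for all $0\le i\le m$ and $0\le j\le n$. *)

theory Defs
  imports "HOL-Algebra.UnivPoly"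
begin

text \<open>The library locale \<open>semiring\<close> does not include \<open>\<one> \<noteq> \<zero>\<close>.\<close>

locale nontrivial_semiring = semiring +
  assumes one_not_zero: "\<one> \<noteq> \<zero>"

definition zerosumfree :: "('a, 'm) ring_scheme \<Rightarrow> bool" where
  "zerosumfree R \<longleftrightarrow>
     (\<forall>s\<in>carrier R. \<forall>t\<in>carrier R. s \<oplus>\<^bsub>R\<^esub> t = \<zero>\<^bsub>R\<^esub> \<longrightarrow> s = \<zero>\<^bsub>R\<^esub> \<and> t = \<zero>\<^bsub>R\<^esub>)"

text \<open>
  The operations of \<open>UP R\<close> used here (finite-support coefficient functions, pointwise addition,
  convolution with the coefficients of the left factor on the left) need neither negation nor
  commutativity, so for a semiring \<open>R\<close> the structure \<open>UP R\<close> is the polynomial semiring in an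
  indeterminate commuting with the coefficients.  The term \<open>monom (UP R) c k\<close> is $c X^k$.  The
  leading coefficients \<open>a m\<close> and \<open>b n\<close> are allowed to be zero.
\<close>

definition armendariz :: "('a, 'm) ring_scheme \<Rightarrow> bool" where
  "armendariz R \<longleftrightarrow>
     (\<forall>m n a b. a \<in> {..m} \<rightarrow> carrier R \<longrightarrow> b \<in> {..n} \<rightarrow> carrier R \<longrightarrow>
        (\<Oplus>\<^bsub>UP R\<^esub>i\<in>{..m}. monom (UP R) (a i) i) \<otimes>\<^bsub>UP R\<^esub>
        (\<Oplus>\<^bsub>UP R\<^esub>j\<in>{..n}. monom (UP R) (b j) j) = \<zero>\<^bsub>UP R\<^esub> \<longrightarrow>
        (\<forall>i\<le>m. \<forall>j\<le>n. a i \<otimes>\<^bsub>R\<^esub> b j = \<zero>\<^bsub>R\<^esub>))"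

end

theory Submission
  imports Defs
begin

text \<open>
  The coefficient of \<open>fg\<close> at \<open>i + j\<close> is a finite sum having \<open>a i \<otimes> b j\<close> as one of its summands,
  and in a zerosumfree semiring a finite sum vanishes only if every summand does.
\<close>

lemma (in abelian_monoid) finsum_eq_zeroD:
  assumes "zerosumfree G" and "finite A" and "f \<in> A \<rightarrow> carrier G"
    and "(\<Oplus>i\<in>A. f i) = \<zero>" and "i \<in> A"
  shows "f i = \<zero>"
proof -
  have f: "f \<in> (A - {i}) \<rightarrow> carrier G" "f i \<in> carrier G"
    using assms by auto
  \<comment> \<open>Splitting off the summand at \<open>i\<close> leaves a sum of two elements, to
    which \<open>zerosumfree\<close> applies directly; no induction on \<open>A\<close> is
    needed.\<close>
  have "f i \<oplus> finsum G f (A - {i}) = finsum G f (insert i (A - {i}))"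
    using f assms(2) by (simp del: insert_Diff_single)
  also have "\<dots> = \<zero>"
    using assms(4,5) by (simp add: insert_absorb)
  finally show ?thesis
    using assms(1) f(2) finsum_closed[OF f(1)] unfolding zerosumfree_def by blast
qed

context abelian_monoid
begin

lemma add_mem_up:
  assumes "p \<in> up G" "q \<in> up G"
  shows "(\<lambda>i. p i \<oplus> q i) \<in> up G"
proof
  fix n
  show "p n \<oplus> q n \<in> carrier G"
    using assms by (simp add: mem_upD)
next
  obtain m n where "bound \<zero> m p" "bound \<zero> n q"
    using assms unfolding up_def by blast
  then have "bound \<zero> (max m n) (\<lambda>i. p i \<oplus> q i)"
    by (auto simp: bound_def)
  then show "\<exists>n. bound \<zero> n (\<lambda>i. p i \<oplus> q i)" ..
qed

text \<open>The polynomials in \<open>armendariz\<close> are finite sums taken in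
  \<open>UP G\<close>, and computing with such sums requires its addition to form a commutative
  monoid. The laws hold coefficientwise.\<close>

lemma abelian_monoid_UP: "abelian_monoid (UP G)"
proof (rule abelian_monoidI)
  have zero: "(\<lambda>i. \<zero>) \<in> up G"
    by (auto simp: bound_def)
  then show "\<zero>\<^bsub>UP G\<^esub> \<in> carrier (UP G)"
    by (simp add: UP_def)
  show "\<zero>\<^bsub>UP G\<^esub> \<oplus>\<^bsub>UP G\<^esub> x = x" if "x \<in> carrier (UP G)" for x
    using zero that by (simp add: UP_def mem_upD)
qed (simp_all add: UP_def add_mem_up mem_upD a_assoc fun_eq_iff, simp_all add: a_comm mem_upD)

lemma monom_mem_up:
  assumes "c \<in> carrier G"
  shows "(\<lambda>i. if i = n then c else \<zero>) \<in> up G"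
  using assms by (auto simp: bound_def intro!: exI[of _ n])

lemma truncation_mem_up:
  assumes "a \<in> {..m::nat} \<rightarrow> carrier G"
  shows "(\<lambda>k. if k \<le> m then a k else \<zero>) \<in> up G"
  using assms by (auto simp: bound_def Pi_def intro!: exI[of _ m])

text \<open>Turns the formal sums of \<open>armendariz\<close> into explicit coefficient functions.
  Since \<open>a\<close> is arbitrary above \<open>m\<close>, the right-hand side has to cut it off
  there.\<close>

lemma finsum_UP_monom:
  assumes "a \<in> {..m::nat} \<rightarrow> carrier G"
  shows "(\<Oplus>\<^bsub>UP G\<^esub>i\<in>{..m}. monom (UP G) (a i) i) = (\<lambda>k. if k \<le> m then a k else \<zero>)"
  using assms
proof (induction m)
  interpret P: abelian_monoid "UP G"
    by (rule abelian_monoid_UP)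
  have monom: "(\<lambda>i. monom (UP G) (a i) i) \<in> {..m} \<rightarrow> carrier (UP G)"
    if "a \<in> {..m} \<rightarrow> carrier G" for m
    using that by (auto simp: UP_def monom_mem_up Pi_def)
  {
    case 0
    then have "(\<Oplus>\<^bsub>UP G\<^esub>i\<in>{..0}. monom (UP G) (a i) i) = monom (UP G) (a 0) 0"
      using monom[of 0] by (intro P.finsum_0) auto
    with 0 show ?case
      by (auto simp: UP_def)
  next
    case (Suc m)
    then have a: "a \<in> {..m} \<rightarrow> carrier G" "a (Suc m) \<in> carrier G"
      by auto
    have "(\<Oplus>\<^bsub>UP G\<^esub>i\<in>{..Suc m}. monom (UP G) (a i) i) =
        monom (UP G) (a (Suc m)) (Suc m) \<oplus>\<^bsub>UP G\<^esub> (\<Oplus>\<^bsub>UP G\<^esub>i\<in>{..m}. monom (UP G) (a i) i)"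
      by (rule P.finsum_Suc) (rule monom[OF Suc.prems])
    \<comment> \<open>The operations of \<open>UP G\<close> are specified only on
      \<open>up G\<close> and \<open>carrier G\<close>, so both summands must be shown to lie in
      \<open>up G\<close> before addition unfolds.\<close>
    also have "\<dots> = (\<lambda>k. (if k = Suc m then a (Suc m) else \<zero>) \<oplus> (if k \<le> m then a k else \<zero>))"
      unfolding Suc.IH[OF a(1)]
      using a truncation_mem_up[OF a(1)] monom_mem_up[OF a(2)] by (simp add: UP_def)
    \<comment> \<open>The supports lie in the disjoint sets \<open>{Suc m}\<close> and
      \<open>{..m}\<close>, so at each index at least one summand is \<open>\<zero>\<close>.\<close>
    also have "\<dots> = (\<lambda>k. if k \<le> Suc m then a k else \<zero>)"
      using a by (auto simp: fun_eq_iff Pi_def le_Suc_eq)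
    finally show ?case .
  }
qed

end

theorem proposition4p3:
  fixes S :: "('a, 'm) ring_scheme"
  assumes "nontrivial_semiring S" and "zerosumfree S"
  shows "armendariz S"
  unfolding armendariz_def
proof (intro allI impI)
  interpret nontrivial_semiring S
    by (rule assms(1))
  fix m n i j :: nat and a b :: "nat \<Rightarrow> 'a"
  assume a: "a \<in> {..m} \<rightarrow> carrier S" and b: "b \<in> {..n} \<rightarrow> carrier S"
    and prod: "(\<Oplus>\<^bsub>UP S\<^esub>i\<in>{..m}. monom (UP S) (a i) i) \<otimes>\<^bsub>UP S\<^esub>
        (\<Oplus>\<^bsub>UP S\<^esub>j\<in>{..n}. monom (UP S) (b j) j) = \<zero>\<^bsub>UP S\<^esub>"
    and ij: "i \<le> m" "j \<le> n"
  \<comment> \<open>Extension by zero: the convolution at \<open>i + j\<close> may use indices above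
    \<open>m\<close> or \<open>n\<close>, where \<open>a\<close> and \<open>b\<close> are
    unconstrained.\<close>
  define p q where "p = (\<lambda>k. if k \<le> m then a k else \<zero>\<^bsub>S\<^esub>)"
    and "q = (\<lambda>k. if k \<le> n then b k else \<zero>\<^bsub>S\<^esub>)"
  have up: "p \<in> up S" "q \<in> up S"
    unfolding p_def q_def using a b by (auto intro: truncation_mem_up)
  have "p \<otimes>\<^bsub>UP S\<^esub> q = \<zero>\<^bsub>UP S\<^esub>"
    using prod finsum_UP_monom[OF a] finsum_UP_monom[OF b] by (simp add: p_def q_def)
  then have "(\<Oplus>\<^bsub>S\<^esub>l\<in>{..i + j}. p l \<otimes>\<^bsub>S\<^esub> q (i + j - l)) = \<zero>\<^bsub>S\<^esub>"
    using up by (simp add: UP_def fun_eq_iff)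
  \<comment> \<open>The summand at \<open>l = i\<close>; its second index \<open>i + j - i\<close>
    is \<open>j\<close>.\<close>
  then have "p i \<otimes>\<^bsub>S\<^esub> q (i + j - i) = \<zero>\<^bsub>S\<^esub>"
    using up finsum_eq_zeroD[OF assms(2), of "{..i + j}" "\<lambda>l. p l \<otimes>\<^bsub>S\<^esub> q (i + j - l)" i]
    by (simp add: mem_upD)
  then show "a i \<otimes>\<^bsub>S\<^esub> b j = \<zero>\<^bsub>S\<^esub>"
    using ij by (simp add: p_def q_def)
qed

end
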